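(* Let $\varepsilon>0$ and $X=\{x_1,x_2\}$. For a parameter $r\in(0,\infty)$ let $d(x_1,x_2)=r$ and $c=d^2$. 1. For $m\in(0,1)$, $\mu=m\delta_{x_1}+(1-m)\delta_{x_2}$, $\dot m\in\mathbb{R}$, $\dot\mu=\dot m(\delta_{x_1}-\delta_{x_2})$, denote by $p$ the amount of mass moving from $x_1$ to $x_2$ in the optimal self-transport plan from $\mu$ to itself, that is, $$p=\frac{1}{2(1-b)}\left[-b+\sqrt{b^2+4m(1-m)b(1-b)}\right],\qquad b=\exp(-2r^2/\varepsilon).$$ Then the metric tensor is given by $$\mathbf{g}_\mu(\dot\mu,\dot\mu)=\frac\varepsilon2\,\dot m^2\,\frac{m(1-m)-p}{p\,(2m(1-m)-p)} .$$ 2. For $m:[0,1]\to[0,1]$ continuously differentiable set $\mu_t=m_t\delta_{x_1}+(1-m_t)\delta_{x_2}$ for $t\in[0,1]$. Then, as $r\to 0$, $$E((\mu_t)_t)=r^2\int_0^1\dot m_t^2\,dt+\mathcal{O}\left(\frac1\varepsilon\|\dot m\|_\infty^2r^4\right).$$ 3. Let $C>0$. In the setting of point 1 (i.e. $m\in(0,1)$, $\mu=m\delta_{x_1}+(1-m)\delta_{x_2}$, $\dot\mu=\dot m(\delta_{x_1}-\delta_{x_2})$), when $\sqrt{m(1-m)}\ge C\exp(-2r^2/\varepsilon)$ it holds $$\mathbf{g}_\mu(\dot\mu,\dot\mu)=\frac\varepsilon2\,\dot m^2\left(\frac{\exp(r^2/\varepsilon)}{2\sqrt{m(1-m)}}+\mathcal{O}\big((m(1-m))^{-1}\big)\right)$$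 with the constant in the $\mathcal{O}$-term only depending on $C$.
   Context: The optimal self-transport plan is the minimizer $\pi$ over couplings of $\mu$ with itself of $\iint c\,d\pi+\varepsilon\,\mathrm{KL}(\pi\,|\,\mu\otimes\mu)$ (Kullback--Leibler divergence), and $p=\pi(\{(x_1,x_2)\})$. For $\mu\in\mathcal{P}(X)$, $f_{\mu,\mu}:X\to\mathbb{R}$ is the unique function with $\int_X\exp\left(\frac1\varepsilon(f_{\mu,\mu}(x)+f_{\mu,\mu}(y)-c(x,y))\right)d\mu(x)=1$ for all $y\in X$; $k_\mu(x,y)=\exp\left(\frac1\varepsilon(f_{\mu,\mu}(x)+f_{\mu,\mu}(y)-c(x,y))\right)$; $K_\mu[\phi](y)=\int_X\phi(x)k_\mu(x,y)\,d\mu(x)$; $H_\mu[\nu](y)=\int_X k_\mu(x,y)\,d\nu(x)$. For a signed measure $\dot\mu$ with total mass $0$, $$\mathbf{g}_\mu(\dot\mu,\dot\mu)=\frac\varepsilon2\langle\dot\mu,(\mathrm{id}-K_\mu^2)^{-1}H_\mu[\dot\mu]\rangle,$$ where the inverse is taken on functions modulo constants ($K_\mu$ fixes constants and $\mathrm{id}-K_\mu^2$ is invertible on this quotient). The energy of the path is $E((\mu_t)_t)=\int_0^1\mathbf{g}_{\mu_t}(\dot\mu_t,\dot\mu_t)\,dt$, where $\dot\mu_t=\dot m_t(\delta_{x_1}-\delta_{x_2})$. *)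

theory Defs
  imports "HOL-Probability.Probability"
begin

text \<open>
  All spaces are finite and discrete, so a probability measure on \<open>X\<close> is an \<open>'a pmf\<close> and a signed
  measure is its weight function \<open>'a \<Rightarrow> real\<close>.
\<close>

definition self_couplings :: "'a pmf \<Rightarrow> ('a \<times> 'a) pmf set" where
  "self_couplings \<mu> = {\<pi>. map_pmf fst \<pi> = \<mu> \<and> map_pmf snd \<pi> = \<mu>}"

text \<open>
  Any coupling of \<open>\<mu>\<close> with itself is absolutely continuous with respect to \<open>\<mu> \<otimes> \<mu>\<close> when the space
  is discrete, so the convention \<open>KL = \<infinity>\<close> off absolute continuity never applies.
  In the library, \<open>KL_divergence b M N\<close> is the divergence of \<open>N\<close> relative to \<open>M\<close>.
\<close>

definition entropic_cost ::
    "real \<Rightarrow> ('a::finite \<Rightarrow> 'a \<Rightarrow> real) \<Rightarrow> 'a pmf \<Rightarrow> ('a \<times> 'a) pmf \<Rightarrow> real" where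
  "entropic_cost \<epsilon> c \<mu> \<pi> =
     measure_pmf.expectation \<pi> (\<lambda>(x, y). c x y)
     + \<epsilon> * KL_divergence (exp 1) (measure_pmf (pair_pmf \<mu> \<mu>)) (measure_pmf \<pi>)"

definition optimal_self_plan ::
    "real \<Rightarrow> ('a::finite \<Rightarrow> 'a \<Rightarrow> real) \<Rightarrow> 'a pmf \<Rightarrow> ('a \<times> 'a) pmf" where
  "optimal_self_plan \<epsilon> c \<mu> =
     (THE \<pi>. is_arg_min (entropic_cost \<epsilon> c \<mu>) (\<lambda>\<pi>. \<pi> \<in> self_couplings \<mu>) \<pi>)"

text \<open>The defining equation is required at every \<open>y\<close>, also outside the support of \<open>\<mu>\<close>.\<close>

definition self_potential ::
    "real \<Rightarrow> ('a::finite \<Rightarrow> 'a \<Rightarrow> real) \<Rightarrow> 'a pmf \<Rightarrow> 'a \<Rightarrow> real" where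
  "self_potential \<epsilon> c \<mu> =
     (THE f. \<forall>y. measure_pmf.expectation \<mu> (\<lambda>x. exp (1 / \<epsilon> * (f x + f y - c x y))) = 1)"

definition self_kernel ::
    "real \<Rightarrow> ('a::finite \<Rightarrow> 'a \<Rightarrow> real) \<Rightarrow> 'a pmf \<Rightarrow> 'a \<Rightarrow> 'a \<Rightarrow> real" where
  "self_kernel \<epsilon> c \<mu> x y =
     exp (1 / \<epsilon> * (self_potential \<epsilon> c \<mu> x + self_potential \<epsilon> c \<mu> y - c x y))"

definition K_op ::
    "real \<Rightarrow> ('a::finite \<Rightarrow> 'a \<Rightarrow> real) \<Rightarrow> 'a pmf \<Rightarrow> ('a \<Rightarrow> real) \<Rightarrow> 'a \<Rightarrow> real" where
  "K_op \<epsilon> c \<mu> \<phi> y = measure_pmf.expectation \<mu> (\<lambda>x. \<phi> x * self_kernel \<epsilon> c \<mu> x y)"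

definition H_op ::
    "real \<Rightarrow> ('a::finite \<Rightarrow> 'a \<Rightarrow> real) \<Rightarrow> 'a pmf \<Rightarrow> ('a \<Rightarrow> real) \<Rightarrow> 'a \<Rightarrow> real" where
  "H_op \<epsilon> c \<mu> \<nu> y = (\<Sum>x\<in>UNIV. self_kernel \<epsilon> c \<mu> x y * \<nu> x)"

text \<open>Functions modulo constants are the quotient \<open>UNIV // mod_const\<close>.\<close>

definition mod_const :: "(('a \<Rightarrow> real) \<times> ('a \<Rightarrow> real)) set" where
  "mod_const = {(\<phi>, \<psi>). \<exists>a. \<forall>x. \<psi> x = \<phi> x + a}"

definition lift_mod_const ::
    "(('a \<Rightarrow> real) \<Rightarrow> 'a \<Rightarrow> real) \<Rightarrow> ('a \<Rightarrow> real) set \<Rightarrow> ('a \<Rightarrow> real) set" where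
  "lift_mod_const T \<Phi> = (\<Union>\<phi>\<in>\<Phi>. mod_const `` {T \<phi>})"

definition pairing :: "('a::finite \<Rightarrow> real) \<Rightarrow> ('a \<Rightarrow> real) \<Rightarrow> real" where
  "pairing \<nu> \<phi> = (\<Sum>x\<in>UNIV. \<nu> x * \<phi> x)"

text \<open>
  \<open>metric_tensor \<epsilon> c \<mu> \<nu>\<close> is \<open>g\<^sub>\<mu>(\<nu>, \<nu>)\<close> for \<open>\<nu>\<close> of total mass zero; all representatives \<open>\<phi>\<close> of a
  class then have the same \<open>pairing \<nu> \<phi>\<close>, and \<open>the_elem\<close> picks this common value.
\<close>

definition metric_tensor ::
    "real \<Rightarrow> ('a::finite \<Rightarrow> 'a \<Rightarrow> real) \<Rightarrow> 'a pmf \<Rightarrow> ('a \<Rightarrow> real) \<Rightarrow> real" where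
  "metric_tensor \<epsilon> c \<mu> \<nu> =
     \<epsilon> / 2 * the_elem (pairing \<nu> `
       the_inv_into (UNIV // mod_const)
         (lift_mod_const (\<lambda>\<phi> y. \<phi> y - K_op \<epsilon> c \<mu> (K_op \<epsilon> c \<mu> \<phi>) y))
         (mod_const `` {H_op \<epsilon> c \<mu> \<nu>}))"

definition path_energy ::
    "real \<Rightarrow> ('a::finite \<Rightarrow> 'a \<Rightarrow> real) \<Rightarrow> (real \<Rightarrow> 'a pmf) \<Rightarrow> (real \<Rightarrow> 'a \<Rightarrow> real) \<Rightarrow> real" where
  "path_energy \<epsilon> c \<mu> \<nu> = integral {0..1} (\<lambda>t. metric_tensor \<epsilon> c (\<mu> t) (\<nu> t))"

text \<open>On a two-point space this is the only metric with distance \<open>r\<close> between the two points.\<close>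

definition two_point_dist :: "real \<Rightarrow> 'a \<Rightarrow> 'a \<Rightarrow> real" where
  "two_point_dist r x y = (if x = y then 0 else r)"

definition two_point_cost :: "real \<Rightarrow> 'a \<Rightarrow> 'a \<Rightarrow> real" where
  "two_point_cost r x y = (two_point_dist r x y)\<^sup>2"

definition two_point_pmf :: "'a \<Rightarrow> 'a \<Rightarrow> real \<Rightarrow> 'a pmf" where
  "two_point_pmf x1 x2 m = map_pmf (\<lambda>b. if b then x1 else x2) (bernoulli_pmf m)"

lemma pmf_two_point_pmf:
  assumes "x1 \<noteq> x2" and "0 \<le> m" and "m \<le> 1"
  shows "pmf (two_point_pmf x1 x2 m) x = m * indicator {x1} x + (1 - m) * indicator {x2} x"
  using assms unfolding two_point_pmf_def map_pmf_def
  by (simp add: pmf_bind indicator_def)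

definition two_point_tangent :: "'a \<Rightarrow> 'a \<Rightarrow> real \<Rightarrow> 'a \<Rightarrow> real" where
  "two_point_tangent x1 x2 dm x = dm * (indicator {x1} x - indicator {x2} x)"

end

theory Submission
  imports Defs
begin

text \<open>
  With \<open>a = exp (2 r\<^sup>2 / \<epsilon>) - 1\<close>, the self-transport equations on two points reduce to the quadratic
  \<open>a m (1 - m) w\<^sup>2 + w = 1\<close> for the off-diagonal kernel value \<open>w\<close>, and \<open>p = m (1 - m) w\<close> since a
  coupling of Gibbs form minimises the entropic cost. Functions modulo constants are
  one-dimensional and \<open>K\<close> acts on them as \<open>1 - w\<close>, so that
  \<open>g = \<epsilon> / 2 dm\<^sup>2 a w / (2 - w) = \<epsilon> / 2 dm\<^sup>2 a / sqrt (1 + 4 m (1 - m) a)\<close> for all \<open>0 \<le> m \<le> 1\<close>.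
  Both asymptotic statements are elementary estimates of this last factor.
\<close>

subsection \<open>Optimal plans of Gibbs form\<close>

lemma KL_divergence_pmf:
  fixes p q :: "'a::finite pmf"
  assumes "1 < b" and "set_pmf q \<subseteq> set_pmf p"
  shows "KL_divergence b (measure_pmf p) (measure_pmf q)
    = (\<Sum>x\<in>UNIV. pmf q x * log b (pmf q x / pmf p x))"
proof -
  interpret sigma_finite_measure "count_space (UNIV :: 'a set)"
    by (rule sigma_finite_measure_count_space_finite) simp
  have ac: "pmf p x = 0 \<longrightarrow> pmf q x = 0" for x
    using assms(2) by (auto simp: set_pmf_iff subset_iff)
  have "KL_divergence b (measure_pmf p) (measure_pmf q)
      = (\<integral>x. pmf q x * log b (pmf q x / pmf p x) \<partial>count_space UNIV)"
    unfolding measure_pmf_eq_density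
    by (rule KL_density_density) (use assms(1) ac in auto)
  then show ?thesis
    by (simp add: lebesgue_integral_count_space_finite)
qed

lemma KL_divergence_pmf_nonneg:
  fixes p q :: "'a::finite pmf"
  assumes "1 < b" and "set_pmf q \<subseteq> set_pmf p"
  shows "0 \<le> KL_divergence b (measure_pmf p) (measure_pmf q)"
proof -
  interpret sigma_finite_measure "count_space (UNIV :: 'a set)"
    by (rule sigma_finite_measure_count_space_finite) simp
  have ac: "pmf p x = 0 \<longrightarrow> pmf q x = 0" for x
    using assms(2) by (auto simp: set_pmf_iff subset_iff)
  have "prob_space (density (count_space UNIV) (pmf r))" for r :: "'a pmf"
    by (metis measure_pmf_eq_density prob_space_measure_pmf)
  then show ?thesis
    unfolding measure_pmf_eq_density
    by (intro KL_density_density_nonneg) (use assms(1) ac in \<open>auto intro: integrable_count_space\<close>)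
qed

lemma KL_divergence_pmf_eq_0_iff:
  fixes p q :: "'a::finite pmf"
  assumes "1 < b" and "set_pmf q \<subseteq> set_pmf p"
  shows "KL_divergence b (measure_pmf p) (measure_pmf q) = 0 \<longleftrightarrow> q = p"
proof -
  interpret information_space "measure_pmf p" b
    by standard (rule assms)
  have "absolutely_continuous (measure_pmf p) (measure_pmf q)"
    using assms(2) by (auto simp: absolutely_continuous_def null_sets_def
      measure_pmf.emeasure_eq_measure measure_pmf_zero_iff)
  then show ?thesis
    by (subst KL_eq_0_iff_eq_ac)
      (auto simp: measure_pmf_inject prob_space_measure_pmf intro: integrable_measure_pmf_finite)
qed

lemma expectation_finite:
  fixes p :: "'a::finite pmf" and f :: "'a \<Rightarrow> real"
  shows "measure_pmf.expectation p f = (\<Sum>x\<in>UNIV. f x * pmf p x)"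
  by (rule integral_measure_pmf_real) auto

text \<open>
  The Gibbs form of a plan turns the entropic cost into a divergence, because the potentials
  integrate to the same value against every coupling.
\<close>

lemma entropic_cost_eq_KL:
  fixes \<mu> :: "'a::finite pmf"
  assumes "\<epsilon> > 0" and \<pi>: "\<pi> \<in> self_couplings \<mu>"
    and P: "\<And>x y. pmf P (x, y) = pmf \<mu> x * pmf \<mu> y * exp (1 / \<epsilon> * (f x + f y - c x y))"
  shows "set_pmf \<pi> \<subseteq> set_pmf P"
    and "entropic_cost \<epsilon> c \<mu> \<pi> = 2 * measure_pmf.expectation \<mu> f
      + \<epsilon> * KL_divergence (exp 1) (measure_pmf P) (measure_pmf \<pi>)"
proof -
  have marg: "map_pmf fst \<pi> = \<mu>" "map_pmf snd \<pi> = \<mu>"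
    using \<pi> by (auto simp: self_couplings_def)
  \<comment> \<open>A pair charged by a coupling has both coordinates charged by
    \<open>\<mu>\<close>. This gives absolute continuity and keeps all logarithms below at positive
    arguments.\<close>
  have supp: "pmf \<mu> x > 0 \<and> pmf \<mu> y > 0" if "(x, y) \<in> set_pmf \<pi>" for x y
  proof -
    have "x \<in> set_pmf \<mu>" "y \<in> set_pmf \<mu>"
      using that by (force simp flip: marg(1), force simp flip: marg(2))
    then show ?thesis
      by (simp add: pmf_positive)
  qed
  show sub: "set_pmf \<pi> \<subseteq> set_pmf P"
    using supp by (force simp: set_pmf_iff P)
  have "set_pmf \<pi> \<subseteq> set_pmf (pair_pmf \<mu> \<mu>)"
    using supp by (force simp: set_pmf_iff pmf_pair)
  then have cost: "entropic_cost \<epsilon> c \<mu> \<pi> = (\<Sum>z\<in>UNIV. pmf \<pi> z * (case z of (x, y) \<Rightarrow> c x y))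
      + \<epsilon> * (\<Sum>z\<in>UNIV. pmf \<pi> z * log (exp 1) (pmf \<pi> z / pmf (pair_pmf \<mu> \<mu>) z))"
    unfolding entropic_cost_def by (simp add: KL_divergence_pmf expectation_finite mult.commute)
  have pot: "measure_pmf.expectation \<mu> f = (\<Sum>z\<in>UNIV. pmf \<pi> z * f (g z))"
    if "map_pmf g \<pi> = \<mu>" for g
    unfolding that[symmetric] by (simp add: expectation_finite[of \<pi>] mult.commute)
  \<comment> \<open>Replacing the reference weight \<open>\<mu> \<otimes> \<mu>\<close> by
    \<open>P\<close> inside the logarithm subtracts
    \<open>1 / \<epsilon> * (f x + f y - c x y)\<close>, which trades the cost for the potentials.
    Where \<open>\<pi>\<close> vanishes both sides are zero.\<close>
  have pointwise: "pmf \<pi> z * (case z of (x, y) \<Rightarrow> c x y)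
        + \<epsilon> * (pmf \<pi> z * log (exp 1) (pmf \<pi> z / pmf (pair_pmf \<mu> \<mu>) z))
      = pmf \<pi> z * f (fst z) + pmf \<pi> z * f (snd z)
        + \<epsilon> * (pmf \<pi> z * log (exp 1) (pmf \<pi> z / pmf P z))" for z
  proof (cases "z \<in> set_pmf \<pi>")
    case True
    obtain x y where z: "z = (x, y)" by force
    have pos: "pmf \<mu> x > 0" "pmf \<mu> y > 0" "pmf \<pi> (x, y) > 0"
      using supp True by (auto simp: z pmf_positive)
    have "ln (pmf \<pi> z / pmf P z)
        = ln (pmf \<pi> z / pmf (pair_pmf \<mu> \<mu>) z) - 1 / \<epsilon> * (f x + f y - c x y)"
      using pos by (simp add: z P pmf_pair ln_div ln_mult)
    then have "\<epsilon> * ln (pmf \<pi> z / pmf P z)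
        = \<epsilon> * ln (pmf \<pi> z / pmf (pair_pmf \<mu> \<mu>) z) - (f x + f y - c x y)"
      using \<open>\<epsilon> > 0\<close> by (simp add: field_simps)
    from arg_cong[OF this, of "(*) (pmf \<pi> z)"] show ?thesis
      by (simp add: z log_def algebra_simps)
  qed (simp add: set_pmf_iff)
  have "entropic_cost \<epsilon> c \<mu> \<pi> = (\<Sum>z\<in>UNIV. pmf \<pi> z * f (fst z) + pmf \<pi> z * f (snd z)
        + \<epsilon> * (pmf \<pi> z * log (exp 1) (pmf \<pi> z / pmf P z)))"
    unfolding cost by (simp add: sum_distrib_left flip: sum.distrib pointwise)
  then show "entropic_cost \<epsilon> c \<mu> \<pi> = 2 * measure_pmf.expectation \<mu> f
      + \<epsilon> * KL_divergence (exp 1) (measure_pmf P) (measure_pmf \<pi>)"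
    using sub by (simp add: sum.distrib KL_divergence_pmf sum_distrib_left
      flip: pot[OF marg(1)] pot[OF marg(2)])
qed

text \<open>Up to a constant, the cost of a coupling is \<open>\<epsilon>\<close> times its
  divergence from \<open>P\<close>. The divergence is nonnegative and vanishes only at
  \<open>P\<close>, so \<open>P\<close> is the unique minimiser and the definite description denotes
  it.\<close>

lemma optimal_self_plan_eqI:
  fixes \<mu> :: "'a::finite pmf"
  assumes \<epsilon>: "\<epsilon> > 0" and P: "P \<in> self_couplings \<mu>"
    "\<And>x y. pmf P (x, y) = pmf \<mu> x * pmf \<mu> y * exp (1 / \<epsilon> * (f x + f y - c x y))"
  shows "optimal_self_plan \<epsilon> c \<mu> = P"
proof -
  let ?KL = "\<lambda>\<pi>. KL_divergence (exp 1) (measure_pmf P) (measure_pmf \<pi>)"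
  have cost: "entropic_cost \<epsilon> c \<mu> \<pi> = 2 * measure_pmf.expectation \<mu> f + \<epsilon> * ?KL \<pi>"
    and nonneg: "0 \<le> ?KL \<pi>" and zero: "?KL \<pi> = 0 \<longleftrightarrow> \<pi> = P"
    if "\<pi> \<in> self_couplings \<mu>" for \<pi>
    using entropic_cost_eq_KL[of \<epsilon> \<pi> \<mu> P f c, OF \<epsilon> that P(2)]
    by (simp_all add: KL_divergence_pmf_nonneg KL_divergence_pmf_eq_0_iff)
  have KL_P: "?KL P = 0"
    using zero[OF P(1)] by simp
  show ?thesis
    unfolding optimal_self_plan_def
  proof (rule the_equality)
    show "is_arg_min (entropic_cost \<epsilon> c \<mu>) (\<lambda>\<pi>. \<pi> \<in> self_couplings \<mu>) P"
      using \<epsilon> P(1) nonneg by (auto simp: is_arg_min_def cost KL_P not_less)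
  next
    fix \<pi> assume "is_arg_min (entropic_cost \<epsilon> c \<mu>) (\<lambda>\<pi>. \<pi> \<in> self_couplings \<mu>) \<pi>"
    then have \<pi>: "\<pi> \<in> self_couplings \<mu>" and "\<not> entropic_cost \<epsilon> c \<mu> P < entropic_cost \<epsilon> c \<mu> \<pi>"
      using P(1) by (auto simp: is_arg_min_def)
    then have "\<not> 0 < ?KL \<pi>"
      using \<epsilon> P(1) by (simp add: cost KL_P zero_less_mult_iff)
    then show "\<pi> = P"
      using nonneg[OF \<pi>] zero[OF \<pi>] by simp
  qed
qed

text \<open>The potential equation says that the Gibbs weights have second marginal
  \<open>\<mu>\<close>, and symmetry of \<open>c\<close> transfers this to the first marginal. The
  weights therefore form a coupling, and a coupling of Gibbs form is optimal.\<close>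

lemma pmf_optimal_self_plan:
  fixes \<mu> :: "'a::finite pmf"
  assumes \<epsilon>: "\<epsilon> > 0" and sym: "\<And>x y. c x y = c y x"
    and f: "\<And>y. measure_pmf.expectation \<mu> (\<lambda>x. exp (1 / \<epsilon> * (f x + f y - c x y))) = 1"
  shows "pmf (optimal_self_plan \<epsilon> c \<mu>) (x, y)
    = pmf \<mu> x * pmf \<mu> y * exp (1 / \<epsilon> * (f x + f y - c x y))"
proof -
  define g where "g = (\<lambda>(x, y). pmf \<mu> x * pmf \<mu> y * exp (1 / \<epsilon> * (f x + f y - c x y)))"
  have snd: "(\<Sum>x\<in>UNIV. g (x, y)) = pmf \<mu> y" for y
  proof -
    have "(\<Sum>x\<in>UNIV. g (x, y)) = pmf \<mu> y * (\<Sum>x\<in>UNIV. exp (1 / \<epsilon> * (f x + f y - c x y)) * pmf \<mu> x)"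
      by (simp add: g_def sum_distrib_left ac_simps)
    then show ?thesis
      using f[of y] by (simp add: expectation_finite)
  qed
  have g_sym: "g (x, y) = g (y, x)" for x y
    using sym[of x y] by (simp add: g_def ac_simps)
  have fst: "(\<Sum>y\<in>UNIV. g (x, y)) = pmf \<mu> x" for x
    by (subst g_sym) (rule snd)
  have nonneg: "0 \<le> g z" for z
    by (auto simp: g_def split: prod.split)
  have "(\<Sum>z\<in>UNIV. g z) = (\<Sum>x\<in>UNIV. \<Sum>y\<in>UNIV. g (x, y))"
    by (simp add: sum.cartesian_product flip: UNIV_Times_UNIV)
  also have "\<dots> = 1"
    by (simp add: fst sum_pmf_eq_1)
  finally have total: "(\<integral>\<^sup>+ z. ennreal (g z) \<partial>count_space UNIV) = 1"
    by (simp add: nn_integral_count_space_finite sum_ennreal nonneg)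
  define P where "P = embed_pmf g"
  have P: "pmf P z = g z" for z
    unfolding P_def by (rule pmf_embed_pmf[OF nonneg total])
  have "pmf (map_pmf fst P) x = pmf \<mu> x" for x
  proof -
    have "fst -` {x} = (\<lambda>y. (x, y)) ` (UNIV :: 'a set)" by auto
    then show ?thesis
      by (simp add: pmf_map measure_measure_pmf_finite sum.reindex inj_on_def P fst)
  qed
  moreover have "pmf (map_pmf snd P) y = pmf \<mu> y" for y
  proof -
    have "snd -` {y} = (\<lambda>x. (x, y)) ` (UNIV :: 'a set)" by auto
    then show ?thesis
      by (simp add: pmf_map measure_measure_pmf_finite sum.reindex inj_on_def P snd)
  qed
  ultimately have "P \<in> self_couplings \<mu>"
    by (simp add: self_couplings_def pmf_eq_iff)
  then have "optimal_self_plan \<epsilon> c \<mu> = P"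
    by (rule optimal_self_plan_eqI[OF \<epsilon>, where f = f]) (simp add: P g_def)
  then show ?thesis
    by (simp add: P g_def)
qed

subsection \<open>Functions modulo constants\<close>

lemma equiv_mod_const: "equiv UNIV mod_const"
proof (rule equivI)
  show "refl mod_const"
    by (auto simp: refl_on_def mod_const_def intro: exI[of _ 0])
  show "sym mod_const"
    by (force simp: mod_const_def sym_def intro: exI[of _ "- a" for a])
  show "trans mod_const"
    by (force simp: mod_const_def trans_def add.assoc)
qed auto

lemma lift_mod_const_class:
  assumes "\<And>\<phi> \<psi>. (\<phi>, \<psi>) \<in> mod_const \<Longrightarrow> (T \<phi>, T \<psi>) \<in> mod_const"
  shows "lift_mod_const T (mod_const `` {\<phi>}) = mod_const `` {T \<phi>}"
proof -
  have "(\<lambda>\<phi>. mod_const `` {T \<phi>}) respects mod_const"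
    by (auto simp: assms intro!: congruentI equiv_class_eq[OF equiv_mod_const])
  then show ?thesis
    unfolding lift_mod_const_def by (intro UN_equiv_class[OF equiv_mod_const]) auto
qed

text \<open>Evaluates the quotient expression in \<open>metric_tensor\<close> from a single function
  solving \<open>T \<phi> = h\<close> up to a constant. One direction of the equivalence makes the
  lift of \<open>T\<close> well defined, the other makes it injective; total mass zero makes the
  pairing constant on a class, so its image is a singleton.\<close>

lemma the_elem_pairing_inverse:
  assumes T: "\<And>\<phi> \<psi>. (T \<phi>, T \<psi>) \<in> mod_const \<longleftrightarrow> (\<phi>, \<psi>) \<in> mod_const"
    and h: "(T \<phi>, h) \<in> mod_const" and \<nu>: "(\<Sum>x\<in>UNIV. \<nu> x) = 0"
  shows "the_elem (pairing \<nu> ` the_inv_into (UNIV // mod_const) (lift_mod_const T)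
    (mod_const `` {h})) = pairing \<nu> \<phi>"
proof -
  have lift: "lift_mod_const T (mod_const `` {\<phi>}) = mod_const `` {T \<phi>}" for \<phi>
    by (rule lift_mod_const_class) (simp add: T)
  have "inj_on (lift_mod_const T) (UNIV // mod_const)"
  proof (rule inj_onI, elim quotientE)
    fix A B \<phi> \<psi>
    assume "lift_mod_const T A = lift_mod_const T B"
      and "A = mod_const `` {\<phi>}" "B = mod_const `` {\<psi>}"
    then show "A = B"
      by (simp only: lift eq_equiv_class_iff[OF equiv_mod_const UNIV_I UNIV_I] T)
  qed
  moreover have "lift_mod_const T (mod_const `` {\<phi>}) = mod_const `` {h}"
    using h by (simp add: lift equiv_class_eq[OF equiv_mod_const])
  ultimately have inv: "the_inv_into (UNIV // mod_const) (lift_mod_const T) (mod_const `` {h})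
      = mod_const `` {\<phi>}"
    by (rule the_inv_into_f_eq) (simp add: quotientI)
  have "pairing \<nu> \<psi> = pairing \<nu> \<phi>" if "(\<phi>, \<psi>) \<in> mod_const" for \<psi>
    using that \<nu> by (auto simp: mod_const_def pairing_def ring_distribs sum.distrib
      simp flip: sum_distrib_right)
  moreover have "\<phi> \<in> mod_const `` {\<phi>}"
    using equiv_class_self[OF equiv_mod_const] by simp
  ultimately have "pairing \<nu> ` mod_const `` {\<phi>} = {pairing \<nu> \<phi>}"
    by (auto simp del: Image_singleton_iff)
  then show ?thesis
    by (simp add: inv)
qed

subsection \<open>The two-point space\<close>

text \<open>
  The off-diagonal value of the self-transport kernel, for \<open>a = exp (2 * r\<^sup>2 / \<epsilon>) - 1\<close>. It is the
  positive root of \<open>a m (1 - m) w\<^sup>2 + w = 1\<close>, written so that it is also correct for \<open>m = 0\<close> and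
  \<open>m = 1\<close>.
\<close>

definition cross_weight :: "real \<Rightarrow> real \<Rightarrow> real" where
  "cross_weight a m = 2 / (1 + sqrt (1 + 4 * (m * (1 - m)) * a))"

lemma cross_weight_pos: "0 \<le> a \<Longrightarrow> 0 \<le> m \<Longrightarrow> m \<le> 1 \<Longrightarrow> 0 < cross_weight a m"
  unfolding cross_weight_def by (intro divide_pos_pos add_pos_nonneg) auto

lemma cross_weight_le_1:
  assumes "0 \<le> a" "0 \<le> m" "m \<le> 1"
  shows "cross_weight a m \<le> 1"
proof -
  have "1 \<le> sqrt (1 + 4 * (m * (1 - m)) * a)"
    using assms by simp
  then show ?thesis
    unfolding cross_weight_def by (intro divide_le_eq_1_pos[THEN iffD2]) linarith+
qed

lemma cross_weight_root:
  assumes "0 \<le> a" "0 \<le> m" "m \<le> 1"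
  shows "a * (m * (1 - m)) * (cross_weight a m)\<^sup>2 + cross_weight a m = 1"
proof -
  define s where "s = sqrt (1 + 4 * (m * (1 - m)) * a)"
  have "0 \<le> s" and s2: "s\<^sup>2 = 1 + 4 * (m * (1 - m)) * a"
    using assms by (simp_all add: s_def)
  then have "a * (m * (1 - m)) = (s\<^sup>2 - 1) / 4" and "1 + s > 0"
    by simp_all
  then show ?thesis
    unfolding cross_weight_def s_def[symmetric]
    by (simp add: divide_simps) (simp add: power2_eq_square algebra_simps)
qed

text \<open>Subtracting the two root equations leaves \<open>w - cross_weight a m\<close> times a
  factor that is positive for positive roots.\<close>

lemma cross_weight_unique:
  assumes "0 \<le> a" "0 \<le> m" "m \<le> 1" and "0 < w" "a * (m * (1 - m)) * w\<^sup>2 + w = 1"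
  shows "w = cross_weight a m"
proof -
  let ?c = "cross_weight a m"
  have "(w - ?c) * (1 + a * (m * (1 - m)) * (w + ?c)) = 0"
    using cross_weight_root[OF assms(1-3)] assms(5) by (simp add: power2_eq_square algebra_simps)
  moreover have "0 < 1 + a * (m * (1 - m)) * (w + ?c)"
    using assms cross_weight_pos[OF assms(1-3)] by (intro add_pos_nonneg mult_nonneg_nonneg) auto
  ultimately show ?thesis by simp
qed

lemma cross_weight_ratio:
  assumes "0 \<le> a" "0 \<le> m" "m \<le> 1"
  shows "cross_weight a m / (2 - cross_weight a m) = 1 / sqrt (1 + 4 * (m * (1 - m)) * a)"
proof -
  define s where "s = sqrt (1 + 4 * (m * (1 - m)) * a)"
  have "0 < s"
    using assms by (simp add: s_def add_pos_nonneg)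
  then have "1 + s \<noteq> 0" "s \<noteq> 0" "2 - 2 / (1 + s) = 2 * s / (1 + s)"
    by (simp_all add: field_simps)
  then show ?thesis
    unfolding cross_weight_def s_def[symmetric] by (simp add: divide_simps)
qed

text \<open>The two factors are the diagonal kernel values. This is the compatibility of these
  values with the off-diagonal value \<open>w\<close>, since \<open>u * v * q = w\<close> and
  \<open>q\<^sup>2 * (1 + a) = 1\<close>.\<close>

lemma cross_weight_prod:
  assumes "0 \<le> a" "0 \<le> m" "m \<le> 1" and "w = cross_weight a m"
  shows "(w + (1 - m) * a * w\<^sup>2) * (w + m * a * w\<^sup>2) = w\<^sup>2 * (1 + a)"
proof -
  have root: "a * (m * (1 - m)) * w\<^sup>2 = 1 - w"
    using cross_weight_root[OF assms(1-3)] assms(4) by simp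
  have "(w + (1 - m) * a * w\<^sup>2) * (w + m * a * w\<^sup>2)
      = w\<^sup>2 * (1 + a * w + a * (a * (m * (1 - m)) * w\<^sup>2))"
    by (simp add: power2_eq_square algebra_simps)
  then show ?thesis
    unfolding root by (simp add: algebra_simps)
qed

text \<open>
  Here \<open>u\<close>, \<open>v\<close> are the exponentials of the potential divided by \<open>\<epsilon>\<close>, and \<open>q = exp (- r\<^sup>2 / \<epsilon>)\<close>.
  The equations determine \<open>m u\<^sup>2\<close> and \<open>(1 - m) v\<^sup>2\<close>; at \<open>m = 0\<close> or \<open>m = 1\<close> the missing value is
  recovered from the product \<open>u\<^sup>2 v\<^sup>2\<close>.
\<close>

lemma two_point_scaling_iff:
  fixes u v q :: real
  assumes "0 \<le> a" "0 \<le> m" "m \<le> 1" and pos: "0 < u" "0 < v" "0 < q"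
    and q: "q\<^sup>2 * (1 + a) = 1" and w: "w = cross_weight a m"
  shows "m * u\<^sup>2 + (1 - m) * (u * v * q) = 1 \<and> m * (u * v * q) + (1 - m) * v\<^sup>2 = 1
    \<longleftrightarrow> u\<^sup>2 = w + (1 - m) * a * w\<^sup>2 \<and> v\<^sup>2 = w + m * a * w\<^sup>2"
    (is "?eqs \<longleftrightarrow> ?vals")
    and "u\<^sup>2 = w + (1 - m) * a * w\<^sup>2 \<Longrightarrow> v\<^sup>2 = w + m * a * w\<^sup>2 \<Longrightarrow> u * v * q = w"
proof -
  have w0: "0 < w"
    using assms cross_weight_pos by simp
  have root: "a * (m * (1 - m)) * w\<^sup>2 + w = 1"
    using cross_weight_root assms by simp
  have prod: "(w + (1 - m) * a * w\<^sup>2) * (w + m * a * w\<^sup>2) = w\<^sup>2 * (1 + a)"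
    using cross_weight_prod assms by blast
  have uvq: "u\<^sup>2 * v\<^sup>2 = (u * v * q)\<^sup>2 * (1 + a)"
    using q by (simp add: power_mult_distrib mult.assoc)
  have a1: "1 + a > 0"
    using assms by simp
  show cross: "u * v * q = w" if "u\<^sup>2 = w + (1 - m) * a * w\<^sup>2" "v\<^sup>2 = w + m * a * w\<^sup>2"
  proof -
    have "(u * v * q)\<^sup>2 = w\<^sup>2"
      using uvq a1 prod unfolding that by simp
    then show ?thesis
      using pos w0 by (simp add: power2_eq_iff_nonneg)
  qed
  show "?eqs \<longleftrightarrow> ?vals"
  proof
    assume eqs: ?eqs
    define x where "x = u * v * q"
    have x0: "0 < x"
      using pos by (simp add: x_def)
    have mu: "m * u\<^sup>2 = 1 - (1 - m) * x" and mv: "(1 - m) * v\<^sup>2 = 1 - m * x"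
      using eqs by (simp_all add: x_def)
    \<comment> \<open>Multiplying the two equations, solved for the diagonal terms, eliminates
      \<open>u\<close> and \<open>v\<close> and leaves the quadratic for the cross term
      \<open>x\<close>.\<close>
    have "m * (1 - m) * (x\<^sup>2 * (1 + a)) = (m * u\<^sup>2) * ((1 - m) * v\<^sup>2)"
      unfolding x_def uvq[symmetric] by simp
    then have "a * (m * (1 - m)) * x\<^sup>2 + x = 1"
      unfolding mu mv by (simp add: power2_eq_square algebra_simps)
    then have xw: "x = w"
      unfolding w using assms x0 by (intro cross_weight_unique)
    have 1: "m * u\<^sup>2 = m * (w + (1 - m) * a * w\<^sup>2)"
      unfolding mu xw using root by algebra
    have 2: "(1 - m) * v\<^sup>2 = (1 - m) * (w + m * a * w\<^sup>2)"
      unfolding mv xw using root by algebra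
    have 3: "u\<^sup>2 * v\<^sup>2 = (w + (1 - m) * a * w\<^sup>2) * (w + m * a * w\<^sup>2)"
      unfolding uvq prod using xw by (simp add: x_def)
    show ?vals
    proof (cases "m = 0")
      case True
      then show ?thesis using 2 3 pos by auto
    next
      case False
      then show ?thesis using 1 3 pos by auto
    qed
  next
    assume vals: ?vals
    then have "u * v * q = w"
      using cross by blast
    moreover have "m * (w + (1 - m) * a * w\<^sup>2) + (1 - m) * w = 1"
      "m * w + (1 - m) * (w + m * a * w\<^sup>2) = 1"
      using root by algebra+
    ultimately show ?eqs
      using vals by simp
  qed
qed

lemma expectation_two_point_pmf:
  fixes g :: "'a \<Rightarrow> real"
  assumes "0 \<le> m" "m \<le> 1"
  shows "measure_pmf.expectation (two_point_pmf x1 x2 m) g = m * g x1 + (1 - m) * g x2"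
  using assms by (simp add: two_point_pmf_def mult.commute)

section \<open>Potential, kernel, plan and metric at a fixed measure on two points\<close>

context
  fixes x1 x2 :: "'a::finite" and \<epsilon> r m a w :: real
  assumes points: "x1 \<noteq> x2" "(UNIV :: 'a set) = {x1, x2}"
    and \<epsilon>: "0 < \<epsilon>" and m: "0 \<le> m" "m \<le> 1"
    and a: "a = exp (2 * r\<^sup>2 / \<epsilon>) - 1" and w: "w = cross_weight a m"
begin

private lemma a_nonneg: "0 \<le> a"
  using \<epsilon> by (simp add: a)

private lemma all_two_points: "(\<forall>y. P y) \<longleftrightarrow> P x1 \<and> P x2"
proof -
  have "(\<forall>y. P y) \<longleftrightarrow> (\<forall>y\<in>UNIV. P y)" by simp
  then show ?thesis unfolding points(2) by simp
qed

private lemma sum_two_points: "(\<Sum>x\<in>UNIV. g x) = g x1 + (g x2 :: real)"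
  unfolding points(2) using points(1) by simp

lemma mod_const_two_points: "(\<phi>, \<psi>) \<in> mod_const \<longleftrightarrow> \<phi> x1 - \<phi> x2 = \<psi> x1 - \<psi> x2"
  unfolding mod_const_def by (auto simp: all_two_points intro!: exI[of _ "\<psi> x1 - \<phi> x1"])

private abbreviation potential_kernel :: "('a \<Rightarrow> real) \<Rightarrow> 'a \<Rightarrow> 'a \<Rightarrow> real" where
  "potential_kernel f x y \<equiv> exp (1 / \<epsilon> * (f x + f y - two_point_cost r x y))"

private lemma potential_kernel_two_point:
  "potential_kernel f x1 x1 = (exp (f x1 / \<epsilon>))\<^sup>2"
  "potential_kernel f x2 x2 = (exp (f x2 / \<epsilon>))\<^sup>2"
  "potential_kernel f x1 x2 = exp (f x1 / \<epsilon>) * exp (f x2 / \<epsilon>) * exp (- (r\<^sup>2 / \<epsilon>))"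
  "potential_kernel f x2 x1 = exp (f x1 / \<epsilon>) * exp (f x2 / \<epsilon>) * exp (- (r\<^sup>2 / \<epsilon>))"
  using points
  by (simp_all add: two_point_cost_def two_point_dist_def power2_eq_square ring_distribs
    flip: exp_add)

lemma exp_half_cost: "(exp (- (r\<^sup>2 / \<epsilon>)))\<^sup>2 * (1 + a) = 1"
  by (simp add: a power2_eq_square flip: exp_add)

private lemma potential_equation_iff:
  "(\<forall>y. measure_pmf.expectation (two_point_pmf x1 x2 m) (\<lambda>x. potential_kernel f x y) = 1)
    \<longleftrightarrow> (exp (f x1 / \<epsilon>))\<^sup>2 = w + (1 - m) * a * w\<^sup>2 \<and> (exp (f x2 / \<epsilon>))\<^sup>2 = w + m * a * w\<^sup>2"
  unfolding all_two_points expectation_two_point_pmf[OF m] potential_kernel_two_point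
  by (rule two_point_scaling_iff) (simp_all add: a_nonneg m exp_half_cost w)

text \<open>The equations fix the squares of \<open>exp (f x1 / \<epsilon>)\<close> and
  \<open>exp (f x2 / \<epsilon>)\<close> at positive values, hence fix \<open>f\<close>. This holds
  for \<open>m = 0\<close> and \<open>m = 1\<close> too, because the equation is imposed at both
  points. It justifies the definite description in \<open>self_potential\<close>.\<close>

private lemma ex1_potential:
  "\<exists>!f. \<forall>y. measure_pmf.expectation (two_point_pmf x1 x2 m) (\<lambda>x. potential_kernel f x y) = 1"
proof (rule ex_ex1I)
  have w0: "0 < w"
    unfolding w by (rule cross_weight_pos[OF a_nonneg m])
  \<comment> \<open>The factor \<open>\<epsilon> / 2\<close> in the witness undoes both the division
    by \<open>\<epsilon>\<close> and the square.\<close>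
  have sqrt_exp: "(exp (\<epsilon> / 2 * ln t / \<epsilon>))\<^sup>2 = t" if "0 < t" for t
    using \<epsilon> that by (simp add: power2_eq_square flip: exp_add)
  have "0 < w + (1 - m) * a * w\<^sup>2" "0 < w + m * a * w\<^sup>2"
    using w0 a_nonneg m by (simp_all add: add_pos_nonneg)
  then show "\<exists>f. \<forall>y. measure_pmf.expectation (two_point_pmf x1 x2 m)
      (\<lambda>x. potential_kernel f x y) = 1"
    unfolding potential_equation_iff
    using points(1) by (intro exI[of _ "\<lambda>x. \<epsilon> / 2 * ln (if x = x1 then w + (1 - m) * a * w\<^sup>2
      else w + m * a * w\<^sup>2)"]) (simp add: sqrt_exp del: times_divide_eq_left)
next
  fix f g
  assume "\<forall>y. measure_pmf.expectation (two_point_pmf x1 x2 m) (\<lambda>x. potential_kernel f x y) = 1"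
    and "\<forall>y. measure_pmf.expectation (two_point_pmf x1 x2 m) (\<lambda>x. potential_kernel g x y) = 1"
  then have "(exp (f x1 / \<epsilon>))\<^sup>2 = (exp (g x1 / \<epsilon>))\<^sup>2" "(exp (f x2 / \<epsilon>))\<^sup>2 = (exp (g x2 / \<epsilon>))\<^sup>2"
    unfolding potential_equation_iff by simp_all
  then show "f = g"
    using \<epsilon> by (simp add: fun_eq_iff all_two_points power2_eq_iff_nonneg)
qed

private lemma self_potential_equation:
  "measure_pmf.expectation (two_point_pmf x1 x2 m)
    (\<lambda>x. potential_kernel (self_potential \<epsilon> (two_point_cost r) (two_point_pmf x1 x2 m)) x y) = 1"
  using theI'[OF ex1_potential] unfolding self_potential_def by blast

lemma self_kernel_two_point:
  "self_kernel \<epsilon> (two_point_cost r) (two_point_pmf x1 x2 m) x1 x1 = w + (1 - m) * a * w\<^sup>2"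
  "self_kernel \<epsilon> (two_point_cost r) (two_point_pmf x1 x2 m) x2 x2 = w + m * a * w\<^sup>2"
  "self_kernel \<epsilon> (two_point_cost r) (two_point_pmf x1 x2 m) x1 x2 = w"
  "self_kernel \<epsilon> (two_point_cost r) (two_point_pmf x1 x2 m) x2 x1 = w"
proof -
  let ?f = "self_potential \<epsilon> (two_point_cost r) (two_point_pmf x1 x2 m)"
  have vals: "(exp (?f x1 / \<epsilon>))\<^sup>2 = w + (1 - m) * a * w\<^sup>2" "(exp (?f x2 / \<epsilon>))\<^sup>2 = w + m * a * w\<^sup>2"
    using self_potential_equation potential_equation_iff by blast+
  moreover have "exp (?f x1 / \<epsilon>) * exp (?f x2 / \<epsilon>) * exp (- (r\<^sup>2 / \<epsilon>)) = w"
    by (rule two_point_scaling_iff(2)[OF a_nonneg m _ _ _ exp_half_cost w vals]) simp_all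
  ultimately show
    "self_kernel \<epsilon> (two_point_cost r) (two_point_pmf x1 x2 m) x1 x1 = w + (1 - m) * a * w\<^sup>2"
    "self_kernel \<epsilon> (two_point_cost r) (two_point_pmf x1 x2 m) x2 x2 = w + m * a * w\<^sup>2"
    "self_kernel \<epsilon> (two_point_cost r) (two_point_pmf x1 x2 m) x1 x2 = w"
    "self_kernel \<epsilon> (two_point_cost r) (two_point_pmf x1 x2 m) x2 x1 = w"
    unfolding self_kernel_def potential_kernel_two_point by simp_all
qed

lemma transported_mass_two_point:
  "pmf (optimal_self_plan \<epsilon> (two_point_cost r) (two_point_pmf x1 x2 m)) (x1, x2)
    = m * (1 - m) * w"
proof -
  have "pmf (optimal_self_plan \<epsilon> (two_point_cost r) (two_point_pmf x1 x2 m)) (x1, x2)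
    = pmf (two_point_pmf x1 x2 m) x1 * pmf (two_point_pmf x1 x2 m) x2
      * self_kernel \<epsilon> (two_point_cost r) (two_point_pmf x1 x2 m) x1 x2"
    unfolding self_kernel_def
    by (rule pmf_optimal_self_plan[OF \<epsilon> _ self_potential_equation])
      (simp add: two_point_cost_def two_point_dist_def)
  then show ?thesis
    using points(1) m by (simp add: self_kernel_two_point pmf_two_point_pmf)
qed

lemma metric_tensor_two_point_weight:
  "metric_tensor \<epsilon> (two_point_cost r) (two_point_pmf x1 x2 m) (two_point_tangent x1 x2 dm)
    = \<epsilon> / 2 * dm\<^sup>2 * (a * (w / (2 - w)))"
proof -
  let ?\<mu> = "two_point_pmf x1 x2 m" and ?\<nu> = "two_point_tangent x1 x2 dm"
  let ?K = "K_op \<epsilon> (two_point_cost r) ?\<mu>" and ?H = "H_op \<epsilon> (two_point_cost r) ?\<mu> ?\<nu>"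
  let ?T = "\<lambda>\<phi> y. \<phi> y - ?K (?K \<phi>) y"
  have w0: "0 < w" and w1: "w \<le> 1"
    unfolding w by (simp_all add: cross_weight_pos cross_weight_le_1 a_nonneg m)
  have root: "a * (m * (1 - m)) * w\<^sup>2 = 1 - w"
    using cross_weight_root[OF a_nonneg m] by (simp add: w)
  \<comment> \<open>The difference of the two values identifies a class modulo constants, so this
    exhibits \<open>1 - w\<close> as the eigenvalue of \<open>?K\<close> on the quotient.\<close>
  have K: "?K \<phi> x1 - ?K \<phi> x2 = (1 - w) * (\<phi> x1 - \<phi> x2)" for \<phi>
  proof -
    have "?K \<phi> x1 - ?K \<phi> x2 = a * (m * (1 - m)) * w\<^sup>2 * (\<phi> x1 - \<phi> x2)"
      by (simp add: K_op_def expectation_two_point_pmf m self_kernel_two_point algebra_simps)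
    then show ?thesis unfolding root .
  qed
  \<comment> \<open>The eigenvalue is \<open>1 - (1 - w)\<^sup>2 = w * (2 - w)\<close>, which is
    nonzero because \<open>0 < w \<le> 1\<close>.\<close>
  have T: "?T \<phi> x1 - ?T \<phi> x2 = w * (2 - w) * (\<phi> x1 - \<phi> x2)" for \<phi>
  proof -
    have "?T \<phi> x1 - ?T \<phi> x2 = (\<phi> x1 - \<phi> x2) - (?K (?K \<phi>) x1 - ?K (?K \<phi>) x2)" by simp
    also have "\<dots> = (\<phi> x1 - \<phi> x2) - (1 - w) * ((1 - w) * (\<phi> x1 - \<phi> x2))"
      unfolding K ..
    finally show ?thesis by (simp add: algebra_simps)
  qed
  have \<nu>: "?\<nu> x1 = dm" "?\<nu> x2 = - dm"
    using points(1) by (simp_all add: two_point_tangent_def)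
  have H: "?H x1 - ?H x2 = dm * (a * w\<^sup>2)"
    by (simp add: H_op_def sum_two_points self_kernel_two_point \<nu> algebra_simps)
  have ww: "w * (2 - w) \<noteq> 0"
    using w0 w1 by simp
  \<comment> \<open>The representative of the inverse image that vanishes at \<open>x2\<close>: its
    value at \<open>x1\<close> is the difference of \<open>?H\<close> divided by the
    eigenvalue.\<close>
  define \<phi> where "\<phi> = (\<lambda>x. if x = x1 then dm * (a * w\<^sup>2) / (w * (2 - w)) else 0)"
  have "the_elem (pairing ?\<nu> ` the_inv_into (UNIV // mod_const) (lift_mod_const ?T)
      (mod_const `` {?H})) = pairing ?\<nu> \<phi>"
  proof (rule the_elem_pairing_inverse)
    show "(?T \<phi>, ?T \<psi>) \<in> mod_const \<longleftrightarrow> (\<phi>, \<psi>) \<in> mod_const" for \<phi> \<psi>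
      unfolding mod_const_two_points T using ww by simp
    show "(?T \<phi>, ?H) \<in> mod_const"
      unfolding mod_const_two_points T H using ww points(1) by (simp add: \<phi>_def)
    show "(\<Sum>x\<in>UNIV. ?\<nu> x) = 0"
      by (simp add: sum_two_points \<nu>)
  qed
  also have "pairing ?\<nu> \<phi> = dm * (dm * (a * w\<^sup>2) / (w * (2 - w)))"
    using points(1) by (simp add: pairing_def sum_two_points \<nu> \<phi>_def)
  also have "\<dots> = dm\<^sup>2 * (a * (w / (2 - w)))"
    using w0 by (simp add: power2_eq_square)
  finally show ?thesis
    by (simp add: metric_tensor_def)
qed

text \<open>This form is free of \<open>p\<close>, so it stays meaningful at the endpoints
  \<open>m = 0\<close> and \<open>m = 1\<close>, which a path may reach, and its continuity in
  \<open>m\<close> is visible.\<close>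

lemma metric_tensor_two_point:
  "metric_tensor \<epsilon> (two_point_cost r) (two_point_pmf x1 x2 m) (two_point_tangent x1 x2 dm)
    = \<epsilon> / 2 * dm\<^sup>2 * (a / sqrt (1 + 4 * (m * (1 - m)) * a))"
  unfolding metric_tensor_two_point_weight
  using cross_weight_ratio[OF a_nonneg m] by (simp add: w)

end

subsection \<open>Estimates of the metric\<close>

lemma transported_mass_eq:
  fixes a b m :: real
  assumes "0 < a" "0 \<le> m" "m \<le> 1" and b: "b * (1 + a) = 1"
  shows "m * (1 - m) * cross_weight a m
    = 1 / (2 * (1 - b)) * (- b + sqrt (b\<^sup>2 + 4 * m * (1 - m) * b * (1 - b)))"
proof -
  define s where "s = sqrt (1 + 4 * (m * (1 - m)) * a)"
  have "0 \<le> s" and s2: "s\<^sup>2 = 1 + 4 * (m * (1 - m)) * a"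
    using assms by (simp_all add: s_def)
  then have s1: "1 + s > 0" and M: "m * (1 - m) = (s\<^sup>2 - 1) / (4 * a)"
    using assms(1) by (simp_all add: field_simps)
  have b0: "0 < b" and ab: "1 - b = a * b"
    using b assms(1) zero_less_mult_pos2[of b "1 + a"] by (simp_all add: algebra_simps)
  \<comment> \<open>With \<open>1 - b = a * b\<close> the radicand contains the factor
    \<open>b\<^sup>2\<close>, and what remains is the radicand of \<open>s\<close>.\<close>
  have "b\<^sup>2 + 4 * m * (1 - m) * b * (1 - b) = b\<^sup>2 * s\<^sup>2"
    unfolding ab s2 by (simp add: power2_eq_square algebra_simps)
  then have "sqrt (b\<^sup>2 + 4 * m * (1 - m) * b * (1 - b)) = b * s"
    using b0 \<open>0 \<le> s\<close> by (simp add: real_sqrt_mult)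
  moreover have "m * (1 - m) * cross_weight a m = (s - 1) / (2 * a)"
    unfolding cross_weight_def s_def[symmetric] unfolding M using s1 assms(1)
    by (simp add: divide_simps) (simp add: power2_eq_square algebra_simps)
  moreover have "(s - 1) / (2 * a) = 1 / (2 * (a * b)) * (- b + b * s)"
    using b0 assms(1) by (simp add: field_simps)
  ultimately show ?thesis
    unfolding ab by simp
qed

text \<open>With \<open>M = m * (1 - m)\<close> the root equation gives
  \<open>M - p = a * M\<^sup>2 * w\<^sup>2\<close>, while \<open>2 * M - p = M * (2 - w)\<close>;
  since \<open>M\<close> and \<open>w\<close> are positive, they cancel from the quotient.\<close>

lemma metric_weight_eq_mass_ratio:
  fixes a m :: real
  assumes "0 \<le> a" "0 < m" "m < 1" and w: "w = cross_weight a m" and p: "p = m * (1 - m) * w"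
  shows "a * (w / (2 - w)) = (m * (1 - m) - p) / (p * (2 * m * (1 - m) - p))"
proof -
  define M where "M = m * (1 - m)"
  have M: "0 < M"
    using assms by (simp add: M_def)
  have w0: "0 < w" and w1: "w \<le> 1"
    using assms by (simp_all add: cross_weight_pos cross_weight_le_1)
  have root: "a * M * w\<^sup>2 + w = 1"
    using cross_weight_root assms by (simp add: M_def)
  have pM: "p = M * w"
    by (simp add: p M_def)
  have "M - p = M * (a * M * w\<^sup>2)"
    unfolding pM using root by algebra
  moreover have "2 * m * (1 - m) - p = M * (2 - w)"
    by (simp add: pM M_def algebra_simps)
  ultimately show ?thesis
    using M w0 w1 unfolding M_def[symmetric] pM by (simp add: power2_eq_square)
qed

section \<open>Metric factor for small cost\<close>

lemma exp_sub_one_bounds: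
  fixes x :: real
  assumes "0 \<le> x" "x \<le> 1"
  shows "x \<le> exp x - 1" "exp x - 1 \<le> x + x\<^sup>2"
  using exp_ge_add_one_self[of x] exp_bound[OF assms] by linarith+

text \<open>From \<open>4 * m * (1 - m) \<le> 1\<close> the square root \<open>s\<close> satisfies
  \<open>1 \<le> s \<le> 1 + a / 2\<close>, so \<open>a - a\<^sup>2 / 2 \<le> a / s \<le> a\<close>
  uniformly in \<open>m\<close>. Together with
  \<open>x \<le> a \<le> x + x\<^sup>2 \<le> 2 * x\<close> this bounds both errors by
  \<open>2 * x\<^sup>2\<close>.\<close>

lemma metric_factor_small_cost:
  fixes x m :: real
  assumes x: "0 \<le> x" "x \<le> 1" and m: "0 \<le> m" "m \<le> 1"
  shows "\<bar>(exp x - 1) / sqrt (1 + 4 * (m * (1 - m)) * (exp x - 1)) - x\<bar> \<le> 2 * x\<^sup>2"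
proof -
  define a where "a = exp x - 1"
  define s where "s = sqrt (1 + 4 * (m * (1 - m)) * a)"
  have a: "x \<le> a" "a \<le> x + x\<^sup>2"
    using exp_sub_one_bounds[OF x] by (simp_all add: a_def)
  have "x\<^sup>2 \<le> x"
    using x by (simp add: power2_eq_square mult_left_le)
  then have a2: "0 \<le> a" "a \<le> 2 * x"
    using a x by linarith+
  have Ma: "0 \<le> m * (1 - m)" "m * (1 - m) \<le> 1 / 4"
    using m mult_left_le[of m m] zero_le_power2[of "2 * m - 1"]
    by (simp_all add: power2_eq_square algebra_simps)
  have s1: "1 \<le> s"
    using Ma a2 by (simp add: s_def)
  have s2: "s\<^sup>2 = 1 + 4 * (m * (1 - m)) * a"
    unfolding s_def using Ma a2 by simp
  have up: "a / s \<le> a"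
    using s1 a2 mult_left_mono[OF s1 a2(1)] by (simp add: divide_le_eq)
  have s_half: "s \<le> 1 + a / 2"
  proof (rule power2_le_imp_le)
    have "s\<^sup>2 \<le> 1 + a"
      using s2 mult_right_mono[OF Ma(2) a2(1)] by simp
    also have "\<dots> \<le> (1 + a / 2)\<^sup>2"
      by (simp add: power2_sum)
    finally show "s\<^sup>2 \<le> (1 + a / 2)\<^sup>2" .
  qed (use a2 in simp)
  have "a * (1 - a / 2) * s \<le> a"
  proof -
    have "(1 - a / 2) * s \<le> 1"
    proof (cases "a \<le> 2")
      case True
      then have "(1 - a / 2) * s \<le> (1 - a / 2) * (1 + a / 2)"
        using s_half by (intro mult_left_mono) auto
      also have "\<dots> \<le> 1"
        by (simp add: algebra_simps)
      finally show ?thesis .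
    next
      case False
      then have "(1 - a / 2) * s \<le> 0"
        using s1 by (intro mult_nonpos_nonneg) auto
      then show ?thesis by simp
    qed
    then show ?thesis
      using mult_left_mono[OF _ a2(1), of "(1 - a / 2) * s" 1] by (simp add: mult.assoc)
  qed
  then have low: "a * (1 - a / 2) \<le> a / s"
    using s1 by (simp add: le_divide_eq)
  have "a\<^sup>2 \<le> (2 * x)\<^sup>2"
    using a2 by (intro power_mono)
  then have "a - a / s \<le> 2 * x\<^sup>2"
    using low by (simp add: power2_eq_square algebra_simps)
  then have "\<bar>a / s - x\<bar> \<le> 2 * x\<^sup>2"
    using up a zero_le_power2[of x] unfolding abs_le_iff by linarith
  then show ?thesis
    by (simp add: a_def s_def)
qed

text \<open>
  With \<open>q = exp (- r\<^sup>2 / \<epsilon>)\<close> and \<open>n = sqrt (m (1 - m))\<close>, the difference is at most of order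
  \<open>q / n\<^sup>3\<close> and also of order \<open>1 / (q n)\<close>; the smaller of the two is at most of order \<open>1 / n\<^sup>2\<close>.
\<close>

lemma metric_factor_large_cost:
  fixes q n a :: real
  assumes q: "0 < q" "q \<le> 1" and n: "0 < n" "n \<le> 1 / 2" and a: "q\<^sup>2 * (1 + a) = 1"
  shows "\<bar>a / sqrt (1 + 4 * n\<^sup>2 * a) - 1 / (2 * q * n)\<bar> \<le> 1 / n\<^sup>2"
proof -
  \<comment> \<open>\<open>S\<close> is \<open>q\<close> times the square root in the denominator.
    Its square is the convex combination of \<open>1\<close> and \<open>4 * n\<^sup>2\<close> with
    weights \<open>q\<^sup>2\<close> and \<open>1 - q\<^sup>2\<close>, whence
    \<open>S \<ge> 2 * n\<close>.\<close>
  define S where "S = sqrt (q\<^sup>2 + 4 * n\<^sup>2 * (1 - q\<^sup>2))"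
  have q2: "q\<^sup>2 \<le> 1"
    using q by (simp add: power_le_one)
  have n2: "4 * n\<^sup>2 \<le> 1"
    using power_mono[OF n(2), of 2] n(1) by (simp add: power2_eq_square)
  have S2: "S\<^sup>2 = q\<^sup>2 + 4 * n\<^sup>2 * (1 - q\<^sup>2)"
    unfolding S_def using q2 by simp
  have "(2 * n)\<^sup>2 \<le> S\<^sup>2"
    unfolding S2 using mult_right_mono[OF n2, of "q\<^sup>2"] by (simp add: algebra_simps)
  then have S_ge: "2 * n \<le> S"
    by (rule power2_le_imp_le) (use q2 in \<open>simp add: S_def\<close>)
  then have S0: "0 < S"
    using n by linarith
  have a_eq: "a = (1 - q\<^sup>2) / q\<^sup>2"
    using a q by (simp add: field_simps)
  have "1 + 4 * n\<^sup>2 * a = S\<^sup>2 / q\<^sup>2"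
    unfolding S2 a_eq using q by (simp add: field_simps)
  then have "sqrt (1 + 4 * n\<^sup>2 * a) = S / q"
    using q S0 by (simp add: real_sqrt_divide)
  then have eq: "a / sqrt (1 + 4 * n\<^sup>2 * a) = (1 - q\<^sup>2) / (q * S)"
    unfolding a_eq using q by (simp add: power2_eq_square)
  have le: "(1 - q\<^sup>2) / (q * S) \<le> 1 / (2 * q * n)"
  proof -
    have "(1 - q\<^sup>2) / (q * S) \<le> 1 / (q * S)"
      using q S0 by (intro divide_right_mono) auto
    also have "\<dots> \<le> 1 / (q * (2 * n))"
      using q n S_ge by (intro divide_left_mono mult_left_mono) auto
    finally show ?thesis by (simp add: ac_simps)
  qed
  have "1 / (2 * q * n) - (1 - q\<^sup>2) / (q * S) \<le> 1 / n\<^sup>2"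
  proof (cases "q \<le> n")
    case True
    \<comment> \<open>Factor \<open>S\<^sup>2 - (2 * n)\<^sup>2\<close> and use that
      \<open>S + 2 * n\<close> is at least \<open>4 * n\<close>.\<close>
    have "S - 2 * n \<le> q\<^sup>2 / (4 * n)"
    proof -
      have "(S - 2 * n) * (4 * n) \<le> (S - 2 * n) * (S + 2 * n)"
        using S_ge by (intro mult_left_mono) auto
      also have "\<dots> = q\<^sup>2 * (1 - 4 * n\<^sup>2)"
        using S2 by (simp add: power2_eq_square algebra_simps)
      also have "\<dots> \<le> q\<^sup>2 * 1"
        by (intro mult_left_mono) auto
      finally show ?thesis
        using n by (simp add: le_divide_eq)
    qed
    moreover have "2 * n * q\<^sup>2 \<le> q\<^sup>2 / (2 * n)"
      using mult_right_mono[OF n2, of "q\<^sup>2"] n by (simp add: field_simps power2_eq_square)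
    moreover have "q\<^sup>2 / (4 * n) + q\<^sup>2 / (2 * n) \<le> q\<^sup>2 / n"
      using n by (simp add: field_simps)
    ultimately have num: "S - 2 * n * (1 - q\<^sup>2) \<le> q\<^sup>2 / n"
      by (simp add: right_diff_distrib)
    have "1 / (2 * q * n) - (1 - q\<^sup>2) / (q * S) = (S - 2 * n * (1 - q\<^sup>2)) / (2 * q * n * S)"
      using q n S0 by (simp add: field_simps)
    also have "\<dots> \<le> (q\<^sup>2 / n) / (2 * q * n * S)"
      using num q n S0 by (intro divide_right_mono) auto
    also have "\<dots> \<le> (q\<^sup>2 / n) / (2 * q * n * (2 * n))"
      using q n S_ge S0 by (intro divide_left_mono mult_left_mono) auto
    also have "\<dots> = q / (4 * n ^ 3)"
      using q n by (simp add: field_simps power2_eq_square power3_eq_cube)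
    also have "\<dots> \<le> n / (4 * n ^ 3)"
      using True n by (intro divide_right_mono) auto
    also have "\<dots> \<le> 1 / n\<^sup>2"
      using n by (simp add: field_simps power2_eq_square power3_eq_cube)
    finally show ?thesis .
  next
    case False
    \<comment> \<open>For \<open>n < q\<close> the main term is itself of order
      \<open>1 / n\<^sup>2\<close>, so the nonnegative subtracted term is dropped.\<close>
    have "1 / (2 * q * n) - (1 - q\<^sup>2) / (q * S) \<le> 1 / (2 * q * n)"
      using q q2 S0 by simp
    also have "\<dots> \<le> 1 / (n * n)"
      using False n q by (intro divide_left_mono mult_right_mono) auto
    finally show ?thesis by (simp add: power2_eq_square)
  qed
  then show ?thesis
    unfolding eq using le by simp
qed

section \<open>Energy of a path\<close>

lemma continuous_metric_factor:
  fixes m :: "'b::topological_space \<Rightarrow> real"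
  assumes "continuous_on T m" and "\<And>t. t \<in> T \<Longrightarrow> 0 \<le> m t \<and> m t \<le> 1" and "0 \<le> a"
  shows "continuous_on T (\<lambda>t. a / sqrt (1 + 4 * (m t * (1 - m t)) * a))"
proof -
  have "1 + 4 * (m t * (1 - m t)) * a > 0" if "t \<in> T" for t
    using assms(2)[OF that] assms(3) by (simp add: add_pos_nonneg)
  then show ?thesis
    by (intro continuous_intros assms(1)) fastforce
qed

text \<open>With \<open>x = 2 * r\<^sup>2 / \<epsilon>\<close> one has
  \<open>\<epsilon> / 2 * x = r\<^sup>2\<close>, the leading coefficient, and the hypothesis on
  \<open>r\<close> says \<open>x \<le> 1\<close>. The pointwise error
  \<open>\<epsilon> / 2 * S\<^sup>2 * (2 * x\<^sup>2)\<close> is then integrated over the unit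
  interval; it is the source of the constant \<open>4\<close>.\<close>

lemma path_energy_two_point_near:
  fixes x1 x2 :: "'a::finite"
  assumes points: "x1 \<noteq> x2" "(UNIV :: 'a set) = {x1, x2}"
    and \<epsilon>: "0 < \<epsilon>" and r: "2 * r\<^sup>2 \<le> \<epsilon>"
    and m: "m ` {0..1} \<subseteq> {0..1}" "continuous_on {0..1} m" and dm: "continuous_on {0..1} dm"
  shows "\<bar>path_energy \<epsilon> (two_point_cost r)
        (\<lambda>t. two_point_pmf x1 x2 (m t)) (\<lambda>t. two_point_tangent x1 x2 (dm t))
      - r\<^sup>2 * integral {0..1} (\<lambda>t. (dm t)\<^sup>2)\<bar>
    \<le> 4 * (1 / \<epsilon> * (SUP t\<in>{0..1}. \<bar>dm t\<bar>)\<^sup>2 * r ^ 4)"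
proof -
  define x where "x = 2 * r\<^sup>2 / \<epsilon>"
  define F where "F t = (exp x - 1) / sqrt (1 + 4 * (m t * (1 - m t)) * (exp x - 1))" for t
  define S where "S = (SUP t\<in>{0..1}. \<bar>dm t\<bar>)"
  let ?g = "\<lambda>t. \<epsilon> / 2 * (dm t)\<^sup>2 * F t"
  have x: "0 \<le> x" "x \<le> 1"
    using \<epsilon> r by (simp_all add: x_def)
  have m01: "0 \<le> m t" "m t \<le> 1" if "t \<in> {0..1}" for t
    using image_subset_iff[THEN iffD1, OF m(1)] that by auto
  \<comment> \<open>A real supremum dominates its family only once boundedness is known; here it
    follows from continuity on a compact interval.\<close>
  have "bdd_above ((\<lambda>t. \<bar>dm t\<bar>) ` {0..1})"
    by (intro bounded_imp_bdd_above compact_imp_bounded compact_continuous_image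
      continuous_intros dm compact_Icc)
  then have dmS: "\<bar>dm t\<bar> \<le> S" if "t \<in> {0..1}" for t
    unfolding S_def using that by (rule cSUP_upper2) auto
  have energy: "path_energy \<epsilon> (two_point_cost r)
      (\<lambda>t. two_point_pmf x1 x2 (m t)) (\<lambda>t. two_point_tangent x1 x2 (dm t)) = integral {0..1} ?g"
    unfolding path_energy_def
    by (intro integral_cong)
      (use metric_tensor_two_point[OF points \<epsilon> m01 refl refl] in \<open>simp add: F_def x_def\<close>)
  have contF: "continuous_on {0..1} F"
    unfolding F_def by (rule continuous_metric_factor[OF m(2)]) (use m01 x in auto)
  have cont: "continuous_on {0..1} ?g" "continuous_on {0..1} (\<lambda>t. r\<^sup>2 * (dm t)\<^sup>2)"
    by (intro continuous_intros dm contF)+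
  have bound: "norm (?g t - r\<^sup>2 * (dm t)\<^sup>2) \<le> 4 * (1 / \<epsilon> * S\<^sup>2 * r ^ 4)" if t: "t \<in> {0..1}" for t
  proof -
    have "?g t - r\<^sup>2 * (dm t)\<^sup>2 = \<epsilon> / 2 * (dm t)\<^sup>2 * (F t - x)"
      using \<epsilon> by (simp add: x_def field_simps)
    then have "norm (?g t - r\<^sup>2 * (dm t)\<^sup>2) = \<epsilon> / 2 * (dm t)\<^sup>2 * \<bar>F t - x\<bar>"
      unfolding real_norm_def using \<epsilon> by (simp only: abs_mult) simp
    also have "\<dots> \<le> \<epsilon> / 2 * S\<^sup>2 * (2 * x\<^sup>2)"
    proof (intro mult_mono)
      show "(dm t)\<^sup>2 \<le> S\<^sup>2"
        using dmS[OF t] by (metis abs_ge_zero power2_abs power_mono)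
      show "\<bar>F t - x\<bar> \<le> 2 * x\<^sup>2"
        unfolding F_def by (rule metric_factor_small_cost[OF x m01[OF t]])
    qed (use \<epsilon> in auto)
    also have "\<dots> = 4 * (1 / \<epsilon> * S\<^sup>2 * r ^ 4)"
      using \<epsilon> by (simp add: x_def power2_eq_square power4_eq_xxxx field_simps)
    finally show ?thesis .
  qed
  have "norm (integral {0..1} (\<lambda>t. ?g t - r\<^sup>2 * (dm t)\<^sup>2)) \<le> 4 * (1 / \<epsilon> * S\<^sup>2 * r ^ 4) * (1 - 0)"
    by (rule integral_bound[OF _ continuous_on_diff[OF cont] bound]) auto
  moreover have "integral {0..1} (\<lambda>t. ?g t - r\<^sup>2 * (dm t)\<^sup>2)
      = integral {0..1} ?g - r\<^sup>2 * integral {0..1} (\<lambda>t. (dm t)\<^sup>2)"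
    by (simp only: integral_diff[OF cont[THEN integrable_continuous_interval]] integral_mult_right)
  ultimately show ?thesis
    unfolding energy S_def by simp
qed

section \<open>The exact metric formula and the two asymptotic statements\<close>

theorem proposition6p3:
  fixes x1 x2 :: "'a::finite"
  assumes "x1 \<noteq> x2" and "(UNIV :: 'a set) = {x1, x2}"
  shows
    "(\<forall>\<epsilon>>0. \<forall>r>0. \<forall>m\<in>{0<..<1}. \<forall>dm p b.
        p = pmf (optimal_self_plan \<epsilon> (two_point_cost r) (two_point_pmf x1 x2 m)) (x1, x2) \<longrightarrow>
        b = exp (- 2 * r\<^sup>2 / \<epsilon>) \<longrightarrow>
        p = 1 / (2 * (1 - b)) * (- b + sqrt (b\<^sup>2 + 4 * m * (1 - m) * b * (1 - b))) \<and>
        metric_tensor \<epsilon> (two_point_cost r) (two_point_pmf x1 x2 m) (two_point_tangent x1 x2 dm)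
          = \<epsilon> / 2 * dm\<^sup>2 * ((m * (1 - m) - p) / (p * (2 * m * (1 - m) - p))))
     \<and>
     (\<exists>A>0. \<forall>\<epsilon>>0. \<forall>\<^sub>F r in at_right 0. \<forall>m dm :: real \<Rightarrow> real.
        m ` {0..1} \<subseteq> {0..1} \<longrightarrow>
        (\<forall>t\<in>{0..1}. (m has_real_derivative dm t) (at t within {0..1})) \<longrightarrow>
        continuous_on {0..1} dm \<longrightarrow>
        \<bar>path_energy \<epsilon> (two_point_cost r)
            (\<lambda>t. two_point_pmf x1 x2 (m t)) (\<lambda>t. two_point_tangent x1 x2 (dm t))
          - r\<^sup>2 * integral {0..1} (\<lambda>t. (dm t)\<^sup>2)\<bar>
        \<le> A * (1 / \<epsilon> * (SUP t\<in>{0..1}. \<bar>dm t\<bar>)\<^sup>2 * r ^ 4))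
     \<and>
     (\<forall>C>0. \<exists>D>0. \<forall>\<epsilon>>0. \<forall>r>0. \<forall>m\<in>{0<..<1}. \<forall>dm.
        sqrt (m * (1 - m)) \<ge> C * exp (- 2 * r\<^sup>2 / \<epsilon>) \<longrightarrow>
        (\<exists>R. \<bar>R\<bar> \<le> D * inverse (m * (1 - m)) \<and>
          metric_tensor \<epsilon> (two_point_cost r) (two_point_pmf x1 x2 m) (two_point_tangent x1 x2 dm)
            = \<epsilon> / 2 * dm\<^sup>2 * (exp (r\<^sup>2 / \<epsilon>) / (2 * sqrt (m * (1 - m))) + R)))"
proof (intro conjI)
  show "\<forall>\<epsilon>>0. \<forall>r>0. \<forall>m\<in>{0<..<1}. \<forall>dm p b.
        p = pmf (optimal_self_plan \<epsilon> (two_point_cost r) (two_point_pmf x1 x2 m)) (x1, x2) \<longrightarrow>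
        b = exp (- 2 * r\<^sup>2 / \<epsilon>) \<longrightarrow>
        p = 1 / (2 * (1 - b)) * (- b + sqrt (b\<^sup>2 + 4 * m * (1 - m) * b * (1 - b))) \<and>
        metric_tensor \<epsilon> (two_point_cost r) (two_point_pmf x1 x2 m) (two_point_tangent x1 x2 dm)
          = \<epsilon> / 2 * dm\<^sup>2 * ((m * (1 - m) - p) / (p * (2 * m * (1 - m) - p)))"
  proof (intro allI ballI impI)
    fix \<epsilon> r m dm p b :: real
    assume \<epsilon>: "0 < \<epsilon>" and r: "0 < r" and m: "m \<in> {0<..<1}"
      and p: "p = pmf (optimal_self_plan \<epsilon> (two_point_cost r) (two_point_pmf x1 x2 m)) (x1, x2)"
      and b: "b = exp (- 2 * r\<^sup>2 / \<epsilon>)"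
    define a where "a = exp (2 * r\<^sup>2 / \<epsilon>) - 1"
    define w where "w = cross_weight a m"
    have m01: "0 \<le> m" "m \<le> 1"
      using m by auto
    have a: "0 < a"
      using \<epsilon> r by (simp add: a_def)
    have ba: "b * (1 + a) = 1"
      by (simp add: a_def b flip: exp_add)
    have pw: "p = m * (1 - m) * w"
      unfolding p by (rule transported_mass_two_point[OF assms \<epsilon> m01 a_def w_def])
    have "metric_tensor \<epsilon> (two_point_cost r) (two_point_pmf x1 x2 m) (two_point_tangent x1 x2 dm)
        = \<epsilon> / 2 * dm\<^sup>2 * (a * (w / (2 - w)))"
      by (rule metric_tensor_two_point_weight[OF assms \<epsilon> m01 a_def w_def])
    also have "a * (w / (2 - w)) = (m * (1 - m) - p) / (p * (2 * m * (1 - m) - p))"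
      by (rule metric_weight_eq_mass_ratio[OF _ _ _ w_def pw]) (use a m in auto)
    finally show "p = 1 / (2 * (1 - b)) * (- b + sqrt (b\<^sup>2 + 4 * m * (1 - m) * b * (1 - b))) \<and>
        metric_tensor \<epsilon> (two_point_cost r) (two_point_pmf x1 x2 m) (two_point_tangent x1 x2 dm)
          = \<epsilon> / 2 * dm\<^sup>2 * ((m * (1 - m) - p) / (p * (2 * m * (1 - m) - p)))"
      using transported_mass_eq[OF a m01 ba] by (simp add: pw w_def)
  qed
next
  \<comment> \<open>The threshold for \<open>r\<close> depends on \<open>\<epsilon>\<close> alone,
    so the energy estimate is uniform over all paths.\<close>
  have near: "\<forall>\<^sub>F r in at_right 0. 2 * r\<^sup>2 \<le> \<epsilon>" if "0 < \<epsilon>" for \<epsilon> :: real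
  proof -
    have "((\<lambda>r. 2 * r\<^sup>2) \<longlongrightarrow> 2 * 0\<^sup>2) (at_right (0 :: real))"
      by (intro tendsto_intros)
    then have "\<forall>\<^sub>F r in at_right 0. 2 * r\<^sup>2 < \<epsilon>"
      using that by (intro order_tendstoD(2)) auto
    then show ?thesis
      by eventually_elim simp
  qed
  show "\<exists>A>0. \<forall>\<epsilon>>0. \<forall>\<^sub>F r in at_right 0. \<forall>m dm :: real \<Rightarrow> real.
        m ` {0..1} \<subseteq> {0..1} \<longrightarrow>
        (\<forall>t\<in>{0..1}. (m has_real_derivative dm t) (at t within {0..1})) \<longrightarrow>
        continuous_on {0..1} dm \<longrightarrow>
        \<bar>path_energy \<epsilon> (two_point_cost r)
            (\<lambda>t. two_point_pmf x1 x2 (m t)) (\<lambda>t. two_point_tangent x1 x2 (dm t))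
          - r\<^sup>2 * integral {0..1} (\<lambda>t. (dm t)\<^sup>2)\<bar>
        \<le> A * (1 / \<epsilon> * (SUP t\<in>{0..1}. \<bar>dm t\<bar>)\<^sup>2 * r ^ 4)"
  proof (intro exI[of _ 4] conjI allI impI)
    fix \<epsilon> :: real assume "0 < \<epsilon>"
    show "\<forall>\<^sub>F r in at_right 0. \<forall>m dm :: real \<Rightarrow> real.
        m ` {0..1} \<subseteq> {0..1} \<longrightarrow>
        (\<forall>t\<in>{0..1}. (m has_real_derivative dm t) (at t within {0..1})) \<longrightarrow>
        continuous_on {0..1} dm \<longrightarrow>
        \<bar>path_energy \<epsilon> (two_point_cost r)
            (\<lambda>t. two_point_pmf x1 x2 (m t)) (\<lambda>t. two_point_tangent x1 x2 (dm t))
          - r\<^sup>2 * integral {0..1} (\<lambda>t. (dm t)\<^sup>2)\<bar>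
        \<le> 4 * (1 / \<epsilon> * (SUP t\<in>{0..1}. \<bar>dm t\<bar>)\<^sup>2 * r ^ 4)"
      using near[OF \<open>0 < \<epsilon>\<close>]
      by eventually_elim
        (intro allI impI path_energy_two_point_near[OF assms \<open>0 < \<epsilon>\<close>]; blast intro: DERIV_continuous_on)
  qed simp
next
  show "\<forall>C>0. \<exists>D>0. \<forall>\<epsilon>>0. \<forall>r>0. \<forall>m\<in>{0<..<1}. \<forall>dm.
        sqrt (m * (1 - m)) \<ge> C * exp (- 2 * r\<^sup>2 / \<epsilon>) \<longrightarrow>
        (\<exists>R. \<bar>R\<bar> \<le> D * inverse (m * (1 - m)) \<and>
          metric_tensor \<epsilon> (two_point_cost r) (two_point_pmf x1 x2 m) (two_point_tangent x1 x2 dm)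
            = \<epsilon> / 2 * dm\<^sup>2 * (exp (r\<^sup>2 / \<epsilon>) / (2 * sqrt (m * (1 - m))) + R))"
  \<comment> \<open>The value \<open>1\<close> for \<open>D\<close> is the constant in
    \<open>metric_factor_large_cost\<close>, applied with \<open>n\<^sup>2 = m * (1 - m)\<close>;
    the remainder \<open>R\<close> chosen below is the exact difference estimated there.\<close>
  proof (intro allI impI, rule exI[of _ 1], intro conjI allI ballI impI)
    fix C \<epsilon> r m dm :: real
    assume \<epsilon>: "0 < \<epsilon>" and m: "m \<in> {0<..<1}"
    define a where "a = exp (2 * r\<^sup>2 / \<epsilon>) - 1"
    define q where "q = exp (- (r\<^sup>2 / \<epsilon>))"
    define n where "n = sqrt (m * (1 - m))"
    have n2: "n\<^sup>2 = m * (1 - m)" and n0: "0 < n"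
      using m by (simp_all add: n_def)
    have "n\<^sup>2 \<le> (1 / 2)\<^sup>2"
      unfolding n2 using zero_le_power2[of "2 * m - 1"] by (simp add: power2_eq_square algebra_simps)
    then have n1: "n \<le> 1 / 2"
      by (rule power2_le_imp_le) simp
    have q: "0 < q" "q \<le> 1"
      using \<epsilon> by (simp_all add: q_def)
    have qa: "q\<^sup>2 * (1 + a) = 1"
      unfolding q_def by (rule exp_half_cost[OF assms \<epsilon> _ _ a_def refl, of m]) (use m in auto)
    have inv_q: "1 / (2 * q * n) = exp (r\<^sup>2 / \<epsilon>) / (2 * n)"
      by (simp add: q_def exp_minus field_simps)
    show "\<exists>R. \<bar>R\<bar> \<le> 1 * inverse (m * (1 - m)) \<and>
          metric_tensor \<epsilon> (two_point_cost r) (two_point_pmf x1 x2 m) (two_point_tangent x1 x2 dm)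
            = \<epsilon> / 2 * dm\<^sup>2 * (exp (r\<^sup>2 / \<epsilon>) / (2 * sqrt (m * (1 - m))) + R)"
      using metric_factor_large_cost[OF q n0 n1 qa]
        metric_tensor_two_point[OF assms \<epsilon> _ _ a_def refl, of m dm] m
      unfolding inv_q n_def[symmetric] n2
      by (intro exI[of _ "a / sqrt (1 + 4 * (m * (1 - m)) * a) - exp (r\<^sup>2 / \<epsilon>) / (2 * n)"])
        (simp add: inverse_eq_divide)
  qed simp
qed

end
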